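(* Let $(\boldsymbol{C}_n)_{n\ge 0}$ be the two-color urn process with irreducible stochastic $2\times 2$ replacement matrix $R$ described in the context, let $\lambda\in(-1,1)$ be the nonprincipal eigenvalue of $R$, and let $\boldsymbol{\xi}\in\mathbb{R}^2$ be a right eigenvector of $R$ for $\lambda$. Then there exist a constant $c>0$ and an increasing function $f:\{1,2,3,\dots\}\to(0,\infty)$, neither depending on $t$ or $n$ (other than through the argument of $f$), such that for every $t>0$ and every $n\ge 1$, $$P\Big(\boldsymbol{C}_{n+1}\boldsymbol{\xi}-\Big(\prod_{j=0}^n\Big(1+\frac{\lambda}{j+1}\Big)\Big)\boldsymbol{C}_0\boldsymbol{\xi}>(n+1)t\Big)\le e^{-c\,t^2 f(n)}.$$
   Context: Urn model: $R$ is a $2\times 2$ irreducible stochastic matrix (nonnegative entries, each row sum equal to $1$). Its Perron–Frobenius (principal) eigenvalue is $1$; the other (nonprincipal) eigenvalue is $\lambda\in(-1,1)$, with right eigenvector $\boldsymbol{\xi}=(\xi_1,\xi_2)^T$, i.e. $R\boldsymbol{\xi}=\lambda\boldsymbol{\xi}$, $\boldsymbol{\xi}\ne \boldsymbol{0}$. The initial composition is the deterministic row vector $\boldsymbol{C}_0=(W_0,B_0)$ with $0\le W_0,B_0\le 1$, $W_0+B_0=1$. Given the composition $\boldsymbol{C}_n=(W_n,B_n)$ at time $n$ (and the past), a color is chosen at random, white with probability $W_n/(n+1)$ and black with probability $B_n/(n+1)$; $\boldsymbol{\chi}_{n+1}$ is the row vector equal to $(1,0)$ if white is chosen and $(0,1)$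 if black is chosen; and $\boldsymbol{C}_{n+1}=\boldsymbol{C}_n+\boldsymbol{\chi}_{n+1}R$. Thus $W_n+B_n=n+1$ for all $n$. $\boldsymbol{C}_n\boldsymbol{\xi}$ denotes the product of a row vector and a column vector (a real number). *)

theory Defs
  imports "HOL-Probability.Probability"
begin

definition stochastic_matrix :: "real ^ 'n ^ 'n \<Rightarrow> bool" where
  "stochastic_matrix R \<longleftrightarrow> (\<forall>i j. 0 \<le> R $ i $ j) \<and> (\<forall>i. (\<Sum>j\<in>UNIV. R $ i $ j) = 1)"

(* For a nonnegative matrix R: every entry is positive in some power R^k with k >= 1. *)
definition irreducible_matrix :: "real ^ 'n ^ 'n \<Rightarrow> bool" where
  "irreducible_matrix R \<longleftrightarrow> (\<forall>i j. \<exists>k\<ge>1. 0 < (((**) R) ^^ k) (mat 1) $ i $ j)"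

(* Components 1 and 2 stand for white and black, so C n = (W_n, B_n). Row vectors are elements
   of real^2, and axis 1 1 = (1,0), axis 2 1 = (0,1). X n is the draw chi_n, for n >= 1
   only; X 0 plays no role. The sigma-algebra F n is the past up to time n: any filtration to
   which the draws are adapted is allowed, in particular the natural one. *)
locale two_color_urn = prob_space M + filtration "space M" F
  for M :: "'a measure" and F :: "nat \<Rightarrow> 'a measure" +
  fixes R :: "real ^ 2 ^ 2"
    and c0 :: "real ^ 2"
    and X :: "nat \<Rightarrow> 'a \<Rightarrow> real ^ 2"
    and C :: "nat \<Rightarrow> 'a \<Rightarrow> real ^ 2"
  assumes subalgebra_F: "\<And>n. subalgebra M (F n)"
    and stochastic: "stochastic_matrix R"
    and irreducible: "irreducible_matrix R"
    and c0_range: "\<And>i. 0 \<le> c0 $ i \<and> c0 $ i \<le> 1"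
    and c0_sum: "c0 $ 1 + c0 $ 2 = 1"
    and C_0: "\<And>\<omega>. \<omega> \<in> space M \<Longrightarrow> C 0 \<omega> = c0"
    and C_Suc: "\<And>n \<omega>. \<omega> \<in> space M \<Longrightarrow> C (Suc n) \<omega> = C n \<omega> + X (Suc n) \<omega> v* R"
    and draw_values: "\<And>n \<omega>. \<omega> \<in> space M \<Longrightarrow> X (Suc n) \<omega> \<in> {axis 1 1, axis 2 1}"
    and draw_adapted: "\<And>n. X (Suc n) \<in> borel_measurable (F (Suc n))"
    and draw_prob: "\<And>n i. AE \<omega> in M.
      real_cond_exp M (F n) (indicator {\<omega> \<in> space M. X (Suc n) \<omega> = axis i 1}) \<omega>
        = C n \<omega> $ i / (real n + 1)"

end

theory Submission
  imports Defs
begin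

text \<open>
  Given the past, \<open>C\<^sub>n \<bullet> \<xi>\<close> is multiplied on average by \<open>a\<^sub>n = 1 + lam / (n + 1)\<close> in one draw, because
  \<open>\<xi>\<close> is an eigenvector. So the deviation \<open>Z\<^sub>n\<close> of \<open>C\<^sub>n \<bullet> \<xi>\<close> from \<open>(a\<^sub>0 \<dots> a\<^bsub>n-1\<^esub>) (C\<^sub>0 \<bullet> \<xi>)\<close> satisfies
  \<open>Z\<^bsub>n+1\<^esub> = a\<^sub>n Z\<^sub>n + lam D\<^bsub>n+1\<^esub>\<close>, where \<open>D\<^bsub>n+1\<^esub>\<close> has conditional mean zero and, given the past, takes only two values,
  at distance \<open>\<bar>\<xi>\<^sub>1 - \<xi>\<^sub>2\<bar>\<close> from each other.

  Applying Hoeffding's lemma conditionally on the past in every step, one finds that \<open>Z\<^sub>n\<close> is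
  sub-Gaussian: \<open>E (exp (s Z\<^sub>n)) \<le> exp (s\<^sup>2 b V\<^sub>n)\<close> with \<open>b = (\<xi>\<^sub>1 - \<xi>\<^sub>2)\<^sup>2 / 8\<close> and
  \<open>V\<^bsub>n+1\<^esub> = a\<^sub>n\<^sup>2 V\<^sub>n + 1\<close>, \<open>V\<^sub>0 = 0\<close> (lemmas \<open>exp_deviation_Suc_le\<close> and \<open>deviation_subgaussian\<close>).
  Working with \<open>Z\<^sub>n\<close> directly, instead of the martingale \<open>Z\<^sub>n / (a\<^sub>0 \<dots> a\<^bsub>n-1\<^esub>)\<close> of the
  Azuma--Hoeffding inequality, keeps the normalising product out of the estimates.
  The Chernoff bound with the optimal \<open>s\<close> then gives the tail
  \<open>exp (- c t\<^sup>2 f(n))\<close> with \<open>c = 2 / (\<xi>\<^sub>1 - \<xi>\<^sub>2)\<^sup>2\<close> and \<open>f(n) = (n + 1)\<^sup>2 / V\<^bsub>n+1\<^esub>\<close>, a function of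
  \<open>lam\<close> and \<open>n\<close> only; for \<open>lam = 0\<close> it is \<open>n + 1\<close>.

  It remains to see that \<open>f\<close> is increasing. Clearing denominators,
  \<open>n\<^sup>2 / V\<^sub>n < (n + 1)\<^sup>2 / V\<^bsub>n+1\<^esub>\<close> says \<open>n\<^sup>2 < V\<^sub>n g\<^sub>n\<close> with \<open>g\<^sub>n = (n + 1)\<^sup>2 - (n a\<^sub>n)\<^sup>2\<close>. This
  inequality passes from \<open>n\<close> to \<open>n + 1\<close> as soon as \<open>g\<close> is nondecreasing, which is an
  elementary estimate for \<open>-1 < lam < 1\<close>
  (lemmas \<open>square_gap_mono_Suc\<close> and \<open>square_lt_variance_proxy_times_gap\<close>).
\<close>

section \<open>Hoeffding's lemma for a two-point distribution\<close>

text \<open>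
  The library's \<open>Hoeffdings_lemma_aux\<close> is this estimate with the smaller of the two
  values shifted to 0. The version for numbers rather than random variables is the one that can be
  applied pointwise to conditional probabilities.
\<close>
lemma two_point_Hoeffding:
  fixes p q x y :: real
  assumes "0 \<le> p" "0 \<le> q" "p + q = 1"
  shows "p * exp x + q * exp y \<le> exp (p * x + q * y + (x - y)\<^sup>2 / 8)"
  using assms
proof (induction x y arbitrary: p q rule: linorder_wlog)
  case (le x y)
  define h where "h = y - x"
  have h: "h \<ge> 0" and p: "p = 1 - q" and y: "y = x + h"
    using le by (auto simp: h_def)
  have pos: "0 < 1 + q * (exp h - 1)"
    using h le by (intro add_pos_nonneg mult_nonneg_nonneg) auto
  have "ln (1 + q * (exp h - 1)) \<le> h * q + h\<^sup>2 / 8"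
    using Hoeffdings_lemma_aux[OF h \<open>0 \<le> q\<close>] by simp
  then have "1 + q * (exp h - 1) \<le> exp (h * q + h\<^sup>2 / 8)"
    using pos by (metis exp_le_cancel_iff exp_ln)
  then have "exp x * (1 + q * (exp h - 1)) \<le> exp x * exp (h * q + h\<^sup>2 / 8)"
    by simp
  then show ?case
    by (simp add: p y exp_add[symmetric] algebra_simps)
next
  case (sym x y)
  from sym(1)[of q p] sym(2-) show ?case
    by (simp add: algebra_simps power2_commute)
qed

section \<open>Growth of the variance proxy\<close>

text \<open>
  Up to a constant factor, an upper bound for the variance of \<open>Z\<^sub>n\<close>: one step scales the deviation
  by \<open>1 + lam / (n + 1)\<close> and adds an uncorrelated error of bounded variance.
\<close>
primrec variance_proxy :: "real \<Rightarrow> nat \<Rightarrow> real" where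
  "variance_proxy lam 0 = 0"
| "variance_proxy lam (Suc n) = (1 + lam / (real n + 1))\<^sup>2 * variance_proxy lam n + 1"

lemma variance_proxy_nonneg: "0 \<le> variance_proxy lam n"
  by (induction n) auto

lemma variance_proxy_Suc_pos: "0 < variance_proxy lam (Suc n)"
  using variance_proxy_nonneg[of lam n] by (simp add: add_nonneg_pos)

definition square_gap :: "real \<Rightarrow> nat \<Rightarrow> real" where
  "square_gap lam n = (real n + 1)\<^sup>2 - (real n * (1 + lam / (real n + 1)))\<^sup>2"

text \<open>
  Put \<open>r\<^sub>m = m (1 + lam / (m + 1))\<close> and \<open>x = 1 / ((m + 1) (m + 2))\<close>. The claim is that
  \<open>r\<^bsub>m+1\<^esub>\<^sup>2 - r\<^sub>m\<^sup>2\<close> is at most \<open>(m + 2)\<^sup>2 - (m + 1)\<^sup>2 = 2 m + 3\<close>. Both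
  \<open>r\<^bsub>m+1\<^esub> - r\<^sub>m\<close> and \<open>r\<^bsub>m+1\<^esub> + r\<^sub>m\<close> are nondecreasing in \<open>lam\<close>, so \<open>lam = 1\<close> is the
  extreme case, where the product is \<open>(1 + x) (2 m + 3) (1 - x)\<close>.
\<close>
lemma square_gap_mono_Suc:
  assumes "-1 < lam" "lam < 1"
  shows "square_gap lam n \<le> square_gap lam (Suc n)"
proof -
  define m where "m = real n"
  define x where "x = 1 / ((m + 1) * (m + 2))"
  have m: "0 \<le> m" by (simp add: m_def)
  have x: "0 < x" using m by (simp add: x_def)
  have mx: "(2 * m + 3) * x \<le> 2"
  proof -
    have "2 * m + 3 \<le> 2 * ((m + 1) * (m + 2))"
      using m by (simp add: algebra_simps)
    then show ?thesis using m by (simp add: x_def divide_simps)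
  qed
  define r where "r = m * (1 + lam / (m + 1))"
  define r' where "r' = (m + 1) * (1 + lam / (m + 2))"
  have diff: "r' - r = 1 + lam * x"
    using m by (simp add: r_def r'_def x_def divide_simps) (simp add: algebra_simps)
  have sum: "r' + r = (2 * m + 1) + lam * (2 - (2 * m + 3) * x)"
    using m by (simp add: r_def r'_def x_def divide_simps) (simp add: algebra_simps)
  have "r'\<^sup>2 - r\<^sup>2 = (r' - r) * (r' + r)"
    by (simp add: power2_eq_square algebra_simps)
  also have "\<dots> \<le> (1 + x) * ((2 * m + 1) + (2 - (2 * m + 3) * x))"
  proof (unfold diff sum, intro mult_mono)
    have "lam * x \<le> 1 * x" by (rule mult_right_mono) (use assms x in auto)
    then show "1 + lam * x \<le> 1 + x" by simp
    have "lam * (2 - (2 * m + 3) * x) \<le> 1 * (2 - (2 * m + 3) * x)"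
      by (rule mult_right_mono) (use assms mx in auto)
    then show "(2 * m + 1) + lam * (2 - (2 * m + 3) * x)
        \<le> (2 * m + 1) + (2 - (2 * m + 3) * x)" by simp
    show "0 \<le> 1 + x" using x by simp
    have "0 \<le> r" "0 \<le> r'"
      using m assms by (auto simp: r_def r'_def divide_simps intro!: mult_nonneg_nonneg)
    then show "0 \<le> (2 * m + 1) + lam * (2 - (2 * m + 3) * x)"
      by (simp flip: sum)
  qed
  also have "\<dots> = (2 * m + 3) * (1 - x\<^sup>2)"
    by (simp add: power2_eq_square algebra_simps)
  also have "\<dots> \<le> (2 * m + 3) * 1"
    using m by (intro mult_left_mono) auto
  finally have "r'\<^sup>2 - r\<^sup>2 \<le> (m + 2)\<^sup>2 - (m + 1)\<^sup>2"
    by (simp add: power2_eq_square algebra_simps)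
  then show ?thesis
    by (simp add: square_gap_def r_def r'_def m_def add_ac)
qed

text \<open>
  The induction step rests on the identity \<open>(n + 1)\<^sup>2 = a\<^sub>n\<^sup>2 n\<^sup>2 + g\<^sub>n\<close>, which has the same shape as the
  recursion \<open>V\<^bsub>n+1\<^esub> = a\<^sub>n\<^sup>2 V\<^sub>n + 1\<close>.
\<close>
lemma square_lt_variance_proxy_times_gap:
  assumes "-1 < lam" "lam < 1"
  shows "(real (Suc n))\<^sup>2 < variance_proxy lam (Suc n) * square_gap lam (Suc n)"
proof (induction n)
  case 0
  have "(1 + lam / 2)\<^sup>2 < (3 / 2)\<^sup>2"
    using assms by (intro power_strict_mono) auto
  then show ?case
    by (simp add: square_gap_def power2_eq_square)
next
  case (Suc n)
  define a where "a = 1 + lam / (real (Suc n) + 1)"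
  define v where "v = variance_proxy lam (Suc n)"
  have v: "variance_proxy lam (Suc (Suc n)) = a\<^sup>2 * v + 1" 
    by (simp add: a_def v_def)
  have a: "0 < a"
    using assms by (simp add: a_def divide_simps)
  have "(real (Suc (Suc n)))\<^sup>2 = a\<^sup>2 * (real (Suc n))\<^sup>2 + square_gap lam (Suc n)"
    by (simp add: square_gap_def a_def power_mult_distrib add_ac)
  also have "\<dots> < a\<^sup>2 * (v * square_gap lam (Suc n)) + square_gap lam (Suc n)"
    using Suc a by (simp add: v_def del: variance_proxy.simps)
  also have "\<dots> = (a\<^sup>2 * v + 1) * square_gap lam (Suc n)"
    by (simp add: algebra_simps)
  also have "\<dots> \<le> (a\<^sup>2 * v + 1) * square_gap lam (Suc (Suc n))"
    by (intro mult_left_mono square_gap_mono_Suc assms)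
       (simp add: v_def variance_proxy_nonneg del: variance_proxy.simps)
  finally show ?case
    by (simp only: v)
qed

lemma strict_mono_square_over_variance_proxy:
  assumes "-1 < lam" "lam < 1"
  shows "strict_mono (\<lambda>n. (real n + 1)\<^sup>2 / variance_proxy lam (n + 1))"
proof (rule strict_monoI_Suc)
  fix n
  define a where "a = 1 + lam / (real (Suc n) + 1)"
  define v where "v = variance_proxy lam (Suc n)"
  have v: "variance_proxy lam (Suc (Suc n)) = a\<^sup>2 * v + 1" 
    by (simp add: a_def v_def)
  have pos: "0 < v" "0 < a\<^sup>2 * v + 1"
    using variance_proxy_Suc_pos[of lam n] variance_proxy_Suc_pos[of lam "Suc n"]
    unfolding v by (simp_all add: v_def del: variance_proxy.simps)
  have "(real n + 1)\<^sup>2 < v * ((real n + 2)\<^sup>2 - ((real n + 1) * a)\<^sup>2)"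
    using square_lt_variance_proxy_times_gap[OF assms, of n]
    by (simp add: square_gap_def a_def v_def add_ac del: variance_proxy.simps)
  then have "(real n + 1)\<^sup>2 * (a\<^sup>2 * v + 1) < (real n + 2)\<^sup>2 * v"
    unfolding power_mult_distrib right_diff_distrib by (simp add: algebra_simps)
  then have "(real n + 1)\<^sup>2 / v < (real n + 2)\<^sup>2 / (a\<^sup>2 * v + 1)"
    using pos by (simp add: divide_simps)
  then show "(real n + 1)\<^sup>2 / variance_proxy lam (n + 1)
      < (real (Suc n) + 1)\<^sup>2 / variance_proxy lam (Suc n + 1)"
    using v by (simp add: v_def add_ac del: variance_proxy.simps)
qed

section \<open>Composition of the urn\<close>

text \<open>
  A constant vector is fixed by a stochastic matrix, so it can only be an eigenvector for the
  principal eigenvalue. This makes the constant \<open>c = 2 / (\<xi>\<^sub>1 - \<xi>\<^sub>2)\<^sup>2\<close> meaningful.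
\<close>
lemma stochastic_eigenvector_components_differ:
  fixes R :: "real ^ 2 ^ 2"
  assumes "stochastic_matrix R" "R *v \<xi> = lam *\<^sub>R \<xi>" "\<xi> \<noteq> 0" "lam \<noteq> 1"
  shows "\<xi> $ 1 \<noteq> \<xi> $ 2"
proof
  assume eq: "\<xi> $ 1 = \<xi> $ 2"
  have "(R *v \<xi>) $ 1 = (R $ 1 $ 1 + R $ 1 $ 2) * \<xi> $ 1"
    by (simp add: matrix_vector_mult_def sum_2 eq algebra_simps)
  also have "R $ 1 $ 1 + R $ 1 $ 2 = 1"
    using assms(1) by (auto simp: stochastic_matrix_def sum_2)
  finally have "(1 - lam) * \<xi> $ 1 = 0"
    using assms(2) by (simp add: algebra_simps)
  then have "\<xi> = 0"
    using assms(4) eq by (simp add: vec_eq_iff forall_2)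
  with assms(3) show False by simp
qed

context two_color_urn
begin

lemma composition_nonneg: "\<omega> \<in> space M \<Longrightarrow> 0 \<le> C n \<omega> $ i"
proof (induction n)
  case (Suc n)
  have "0 \<le> (X (Suc n) \<omega> v* R) $ i"
    using draw_values[OF Suc.prems, of n] stochastic
    by (auto simp: stochastic_matrix_def vector_matrix_mult_def axis_def intro!: sum_nonneg)
  with Suc show ?case by (simp add: C_Suc)
qed (simp add: C_0 c0_range)

lemma composition_sum: "\<omega> \<in> space M \<Longrightarrow> C n \<omega> $ 1 + C n \<omega> $ 2 = real n + 1"
proof (induction n)
  case (Suc n)
  have "(X (Suc n) \<omega> v* R) $ 1 + (X (Suc n) \<omega> v* R) $ 2 = 1"
    using draw_values[OF Suc.prems, of n] stochastic
    by (auto simp: stochastic_matrix_def vector_matrix_mult_def axis_def sum_2)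
  with Suc show ?case by (simp add: C_Suc)
qed (simp add: C_0 c0_sum)

lemma composition_le:
  assumes "\<omega> \<in> space M" shows "C n \<omega> $ i \<le> real n + 1"
  using composition_sum[OF assms, of n] composition_nonneg[OF assms, of n 1]
    composition_nonneg[OF assms, of n 2] exhaust_2[of i] by auto

lemma composition_adapted: "C n \<in> borel_measurable (F n)"
proof (induction n)
  case 0
  have "C 0 \<in> borel_measurable (F 0) \<longleftrightarrow> (\<lambda>_. c0) \<in> borel_measurable (F 0)"
    by (rule measurable_cong) (simp add: space_F C_0)
  then show ?case by simp
next
  case (Suc n)
  have "F n \<rightarrow>\<^sub>M (borel :: (real ^ 2) measure) \<subseteq> F (Suc n) \<rightarrow>\<^sub>M borel"
    by (rule measurable_mono) (auto simp: space_F sets_F_mono)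
  with Suc have [measurable]: "C n \<in> borel_measurable (F (Suc n))" by blast
  note [measurable] = draw_adapted[of n]
  have "(\<lambda>x :: real ^ 2. x v* R) \<in> borel_measurable borel"
    unfolding transpose_matrix_vector[symmetric]
    by (intro borel_measurable_continuous_onI matrix_vector_mult_linear_continuous_on)
  then have [measurable]: "(\<lambda>\<omega>. X (Suc n) \<omega> v* R) \<in> borel_measurable (F (Suc n))"
    by measurable
  have "C (Suc n) \<in> borel_measurable (F (Suc n)) \<longleftrightarrow>
      (\<lambda>\<omega>. C n \<omega> + X (Suc n) \<omega> v* R) \<in> borel_measurable (F (Suc n))"
    by (rule measurable_cong) (simp add: space_F C_Suc)
  then show ?case by simp
qed

section \<open>Deviation from the mean\<close>

definition deviation :: "real \<Rightarrow> real ^ 2 \<Rightarrow> nat \<Rightarrow> 'a \<Rightarrow> real" where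
  "deviation lam \<xi> n \<omega> = C n \<omega> \<bullet> \<xi> - (\<Prod>j<n. 1 + lam / (real j + 1)) * (C 0 \<omega> \<bullet> \<xi>)"

lemma deviation_Suc:
  assumes "R *v \<xi> = lam *\<^sub>R \<xi>" "\<omega> \<in> space M"
  shows "deviation lam \<xi> (Suc n) \<omega> = (1 + lam / (real n + 1)) * deviation lam \<xi> n \<omega>
    + lam * (X (Suc n) \<omega> \<bullet> \<xi> - (C n \<omega> \<bullet> \<xi>) / (real n + 1))"
proof -
  have "(X (Suc n) \<omega> v* R) \<bullet> \<xi> = lam * (X (Suc n) \<omega> \<bullet> \<xi>)"
    using assms(1) by (simp add: dot_lmul_matrix)
  then show ?thesis
    using assms(2)
    by (simp add: deviation_def C_Suc inner_add_left ring_distribs diff_divide_distrib mult_ac)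
qed

lemma deviation_adapted: "deviation lam \<xi> n \<in> borel_measurable (F n)"
proof -
  have "F 0 \<rightarrow>\<^sub>M (borel :: (real ^ 2) measure) \<subseteq> F n \<rightarrow>\<^sub>M borel"
    by (rule measurable_mono) (auto simp: space_F sets_F_mono)
  with composition_adapted[of 0] have [measurable]: "C 0 \<in> borel_measurable (F n)" by blast
  note [measurable] = composition_adapted[of n]
  show ?thesis unfolding deviation_def by measurable
qed

lemma composition_inner_bounded:
  assumes "\<omega> \<in> space M"
  shows "\<bar>C n \<omega> \<bullet> \<xi>\<bar> \<le> (real n + 1) * (\<bar>\<xi> $ 1\<bar> + \<bar>\<xi> $ 2\<bar>)"
proof -
  have "\<bar>C n \<omega> \<bullet> \<xi>\<bar> \<le> \<bar>C n \<omega> $ 1 * \<xi> $ 1\<bar> + \<bar>C n \<omega> $ 2 * \<xi> $ 2\<bar>"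
    by (simp add: inner_vec_def sum_2)
  also have "\<dots> \<le> (real n + 1) * \<bar>\<xi> $ 1\<bar> + (real n + 1) * \<bar>\<xi> $ 2\<bar>"
    unfolding abs_mult
    by (intro add_mono mult_right_mono)
       (auto simp: composition_nonneg[OF assms] composition_le[OF assms])
  finally show ?thesis by (simp add: algebra_simps)
qed

lemma deviation_bounded: "\<exists>K. \<forall>\<omega>\<in>space M. \<bar>deviation lam \<xi> n \<omega>\<bar> \<le> K"
proof (intro exI ballI)
  fix \<omega> assume \<omega>: "\<omega> \<in> space M"
  let ?P = "\<Prod>j<n. 1 + lam / (real j + 1)" and ?k = "\<bar>\<xi> $ 1\<bar> + \<bar>\<xi> $ 2\<bar>"
  have "\<bar>deviation lam \<xi> n \<omega>\<bar> \<le> \<bar>C n \<omega> \<bullet> \<xi>\<bar> + \<bar>?P\<bar> * \<bar>C 0 \<omega> \<bullet> \<xi>\<bar>"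
    unfolding deviation_def abs_mult[symmetric] by (rule abs_triangle_ineq4)
  also have "\<dots> \<le> (real n + 1) * ?k + \<bar>?P\<bar> * ?k"
    using composition_inner_bounded[OF \<omega>, of n \<xi>] composition_inner_bounded[OF \<omega>, of 0 \<xi>]
    by (intro add_mono mult_left_mono) auto
  finally show "\<bar>deviation lam \<xi> n \<omega>\<bar> \<le> (real n + 1) * ?k + \<bar>?P\<bar> * ?k" .
qed

lemma integrable_exp_bounded:
  fixes Y :: "'a \<Rightarrow> real"
  assumes "Y \<in> borel_measurable M" "\<And>\<omega>. \<omega> \<in> space M \<Longrightarrow> \<bar>Y \<omega>\<bar> \<le> K"
  shows "integrable M (\<lambda>\<omega>. exp (Y \<omega>))"
proof (rule integrable_const_bound[where B = "exp K"])
  show "AE \<omega> in M. norm (exp (Y \<omega>)) \<le> exp K"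
    by (rule AE_I2) (use assms(2) abs_le_D1 in auto)
qed (use assms(1) in measurable)

lemma integrable_exp_deviation: "integrable M (\<lambda>\<omega>. exp (s * deviation lam \<xi> n \<omega>))"
proof -
  obtain K where K: "\<forall>\<omega>\<in>space M. \<bar>deviation lam \<xi> n \<omega>\<bar> \<le> K"
    using deviation_bounded by blast
  note [measurable] = measurable_from_subalg[OF subalgebra_F deviation_adapted]
  show ?thesis
    by (rule integrable_exp_bounded[where K = "\<bar>s\<bar> * K"])
       (use K in \<open>auto simp: abs_mult intro!: mult_left_mono\<close>)
qed

section \<open>Exponential moments and the tail bound\<close>

text \<open>
  The factor \<open>G\<close> collects the part of \<open>exp (s Z\<^bsub>n+1\<^esub>)\<close> that the past determines; the rest is
  \<open>exp (s lam \<xi>\<^sub>i)\<close> on the event that colour \<open>i\<close> is drawn. Under the integral against \<open>G\<close>, the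
  indicators of these events may be replaced by the conditional probabilities \<open>C\<^sub>n $ i / (n + 1)\<close>. The
  two-point estimate bounds the resulting convex combination of exponentials, and its mean
  \<open>s lam (C\<^sub>n \<bullet> \<xi>) / (n + 1)\<close> cancels against the compensator in \<open>G\<close>.
\<close>
lemma exp_deviation_Suc_le:
  assumes eig: "R *v \<xi> = lam *\<^sub>R \<xi>"
  shows "expectation (\<lambda>\<omega>. exp (s * deviation lam \<xi> (Suc n) \<omega>))
    \<le> exp ((s * lam * (\<xi> $ 1 - \<xi> $ 2))\<^sup>2 / 8)
      * expectation (\<lambda>\<omega>. exp (s * (1 + lam / (real n + 1)) * deviation lam \<xi> n \<omega>))"
proof -
  define a where "a = 1 + lam / (real n + 1)"
  define N where "N = real n + 1"
  have N: "0 < N" by (simp add: N_def)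
  define Y where "Y \<omega> = s * a * deviation lam \<xi> n \<omega> - s * lam * (C n \<omega> \<bullet> \<xi>) / N" for \<omega>
  define G where "G \<omega> = exp (Y \<omega>)" for \<omega>
  define A where "A i = {\<omega> \<in> space M. X (Suc n) \<omega> = axis i 1}" for i :: 2
  define w where "w i = exp (s * lam * \<xi> $ i)" for i
  define p where "p i = real_cond_exp M (F n) (indicator (A i))" for i
  interpret cond: finite_measure_subalgebra M "F n"
    by unfold_locales (rule subalgebra_F)
  note [measurable] = deviation_adapted[of lam \<xi> n] composition_adapted[of n]
  have YF [measurable]: "Y \<in> borel_measurable (F n)"
    unfolding Y_def by measurable
  have GF [measurable]: "G \<in> borel_measurable (F n)"
    unfolding G_def by measurable
  have Y_M: "Y \<in> borel_measurable M"
    by (rule measurable_from_subalg[OF subalgebra_F YF])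
  have X_M: "X (Suc n) \<in> borel_measurable M"
    by (rule measurable_from_subalg[OF subalgebra_F draw_adapted])
  have A_M [measurable]: "A i \<in> sets M" for i
    unfolding A_def using X_M by measurable
  have int_G: "integrable M G"
  proof -
    obtain K where K: "\<forall>\<omega>\<in>space M. \<bar>deviation lam \<xi> n \<omega>\<bar> \<le> K"
      using deviation_bounded by blast
    have "\<bar>Y \<omega>\<bar> \<le> \<bar>s * a\<bar> * K + \<bar>s * lam\<bar> * (\<bar>\<xi> $ 1\<bar> + \<bar>\<xi> $ 2\<bar>)" if \<omega>: "\<omega> \<in> space M" for \<omega>
    proof -
      have "\<bar>(C n \<omega> \<bullet> \<xi>) / N\<bar> \<le> \<bar>\<xi> $ 1\<bar> + \<bar>\<xi> $ 2\<bar>"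
        using composition_inner_bounded[OF \<omega>, of n \<xi>] N
        by (simp add: N_def divide_simps mult.commute)
      then have "\<bar>s * lam\<bar> * \<bar>(C n \<omega> \<bullet> \<xi>) / N\<bar> \<le> \<bar>s * lam\<bar> * (\<bar>\<xi> $ 1\<bar> + \<bar>\<xi> $ 2\<bar>)"
        by (intro mult_left_mono) auto
      moreover have "\<bar>s * a\<bar> * \<bar>deviation lam \<xi> n \<omega>\<bar> \<le> \<bar>s * a\<bar> * K"
        using K \<omega> by (intro mult_left_mono) auto
      moreover have "\<bar>Y \<omega>\<bar> \<le> \<bar>s * a\<bar> * \<bar>deviation lam \<xi> n \<omega>\<bar> + \<bar>s * lam\<bar> * \<bar>(C n \<omega> \<bullet> \<xi>) / N\<bar>"
        unfolding Y_def abs_mult[symmetric] times_divide_eq_right by (rule abs_triangle_ineq4)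
      ultimately show ?thesis by linarith
    qed
    then show ?thesis unfolding G_def by (intro integrable_exp_bounded[OF Y_M])
  qed
  have int_ind: "integrable M (\<lambda>\<omega>. G \<omega> * indicator (A i) \<omega>)" for i
    using integrable_mult_indicator[OF A_M int_G, of i] by (simp add: mult.commute)
  note int_p = cond.real_cond_exp_intg(1)[OF int_ind GF borel_measurable_indicator[OF A_M]]
  note eq_p = cond.real_cond_exp_intg(2)[OF int_ind GF borel_measurable_indicator[OF A_M]]
  have split: "exp (s * deviation lam \<xi> (Suc n) \<omega>)
      = w 1 * (G \<omega> * indicator (A 1) \<omega>) + w 2 * (G \<omega> * indicator (A 2) \<omega>)"
    if \<omega>: "\<omega> \<in> space M" for \<omega>
  proof -
    have ne: "axis 1 1 \<noteq> (axis 2 1 :: real ^ 2)"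
      by (simp add: axis_eq_axis)
    have "s * deviation lam \<xi> (Suc n) \<omega> = s * lam * (X (Suc n) \<omega> \<bullet> \<xi>) + Y \<omega>"
      by (simp add: deviation_Suc[OF eig \<omega>] Y_def a_def N_def algebra_simps)
    then show ?thesis
      using draw_values[OF \<omega>, of n] ne \<omega>
      by (auto simp: A_def G_def w_def exp_add inner_axis')
  qed
  have "expectation (\<lambda>\<omega>. exp (s * deviation lam \<xi> (Suc n) \<omega>))
      = expectation (\<lambda>\<omega>. w 1 * (G \<omega> * indicator (A 1) \<omega>) + w 2 * (G \<omega> * indicator (A 2) \<omega>))"
    by (intro Bochner_Integration.integral_cong split) simp
  also have "\<dots> = expectation (\<lambda>\<omega>. w 1 * (G \<omega> * p 1 \<omega>) + w 2 * (G \<omega> * p 2 \<omega>))"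
    using int_ind int_p by (simp add: eq_p p_def)
  also have "\<dots> \<le> expectation (\<lambda>\<omega>. exp ((s * lam * (\<xi> $ 1 - \<xi> $ 2))\<^sup>2 / 8)
      * exp (s * a * deviation lam \<xi> n \<omega>))"
  proof (rule integral_mono_AE)
    show "integrable M (\<lambda>\<omega>. w 1 * (G \<omega> * p 1 \<omega>) + w 2 * (G \<omega> * p 2 \<omega>))"
      using int_p by (auto simp: p_def)
    show "integrable M (\<lambda>\<omega>. exp ((s * lam * (\<xi> $ 1 - \<xi> $ 2))\<^sup>2 / 8)
      * exp (s * a * deviation lam \<xi> n \<omega>))"
      by (intro integrable_mult_right integrable_exp_deviation)
    have p1: "AE \<omega> in M. p 1 \<omega> = C n \<omega> $ 1 / N" and p2: "AE \<omega> in M. p 2 \<omega> = C n \<omega> $ 2 / N"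
      unfolding p_def A_def N_def by (rule draw_prob)+
    show "AE \<omega> in M. w 1 * (G \<omega> * p 1 \<omega>) + w 2 * (G \<omega> * p 2 \<omega>)
        \<le> exp ((s * lam * (\<xi> $ 1 - \<xi> $ 2))\<^sup>2 / 8) * exp (s * a * deviation lam \<xi> n \<omega>)"
      using p1 p2 AE_space
    proof eventually_elim
      case (elim \<omega>)
      have "p 1 \<omega> + p 2 \<omega> = 1"
        using elim composition_sum[of \<omega> n] N by (simp add: N_def flip: add_divide_distrib)
      moreover have "0 \<le> p 1 \<omega>" "0 \<le> p 2 \<omega>"
        using elim composition_nonneg[of \<omega> n] N by simp_all
      ultimately have "p 1 \<omega> * w 1 + p 2 \<omega> * w 2
          \<le> exp (p 1 \<omega> * (s * lam * \<xi> $ 1) + p 2 \<omega> * (s * lam * \<xi> $ 2)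
              + (s * lam * \<xi> $ 1 - s * lam * \<xi> $ 2)\<^sup>2 / 8)"
        unfolding w_def by (intro two_point_Hoeffding)
      also have "p 1 \<omega> * (s * lam * \<xi> $ 1) + p 2 \<omega> * (s * lam * \<xi> $ 2)
          = s * lam * (C n \<omega> \<bullet> \<xi>) / N"
        using elim by (simp add: inner_vec_def sum_2 add_divide_distrib algebra_simps)
      also have "s * lam * \<xi> $ 1 - s * lam * \<xi> $ 2 = s * lam * (\<xi> $ 1 - \<xi> $ 2)"
        by (simp add: algebra_simps)
      finally have "G \<omega> * (p 1 \<omega> * w 1 + p 2 \<omega> * w 2)
          \<le> G \<omega> * exp (s * lam * (C n \<omega> \<bullet> \<xi>) / N + (s * lam * (\<xi> $ 1 - \<xi> $ 2))\<^sup>2 / 8)"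
        by (intro mult_left_mono) (simp_all add: G_def)
      also have "\<dots> = exp ((s * lam * (\<xi> $ 1 - \<xi> $ 2))\<^sup>2 / 8) * exp (s * a * deviation lam \<xi> n \<omega>)"
        by (simp add: G_def Y_def flip: exp_add)
      finally show ?case by (simp add: algebra_simps)
    qed
  qed
  also have "\<dots> = exp ((s * lam * (\<xi> $ 1 - \<xi> $ 2))\<^sup>2 / 8)
      * expectation (\<lambda>\<omega>. exp (s * a * deviation lam \<xi> n \<omega>))"
    by simp
  finally show ?thesis by (simp only: a_def)
qed

text \<open>
  The parameter \<open>s\<close> has to vary in the induction, since a step replaces \<open>s\<close> by \<open>s a\<^sub>n\<close>; this is
  where the factor \<open>a\<^sub>n\<^sup>2\<close> in the variance proxy comes from.
\<close>
lemma deviation_subgaussian: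
  assumes eig: "R *v \<xi> = lam *\<^sub>R \<xi>" and lam: "\<bar>lam\<bar> \<le> 1"
  shows "expectation (\<lambda>\<omega>. exp (s * deviation lam \<xi> n \<omega>))
    \<le> exp (s\<^sup>2 * ((\<xi> $ 1 - \<xi> $ 2)\<^sup>2 / 8) * variance_proxy lam n)"
proof (induction n arbitrary: s)
  case 0
  show ?case by (simp add: deviation_def prob_space)
next
  case (Suc n)
  define a where "a = 1 + lam / (real n + 1)"
  define b where "b = (\<xi> $ 1 - \<xi> $ 2)\<^sup>2 / 8"
  have "expectation (\<lambda>\<omega>. exp (s * deviation lam \<xi> (Suc n) \<omega>))
      \<le> exp ((s * lam * (\<xi> $ 1 - \<xi> $ 2))\<^sup>2 / 8)
        * expectation (\<lambda>\<omega>. exp (s * a * deviation lam \<xi> n \<omega>))"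
    unfolding a_def by (rule exp_deviation_Suc_le[OF eig])
  also have "\<dots> \<le> exp (s\<^sup>2 * b) * exp ((s * a)\<^sup>2 * b * variance_proxy lam n)"
  proof (intro mult_mono)
    have "lam\<^sup>2 \<le> 1" using lam by (simp add: abs_square_le_1)
    then have "(s\<^sup>2 * b) * lam\<^sup>2 \<le> (s\<^sup>2 * b) * 1"
      by (intro mult_left_mono) (simp_all add: b_def)
    then show "exp ((s * lam * (\<xi> $ 1 - \<xi> $ 2))\<^sup>2 / 8) \<le> exp (s\<^sup>2 * b)"
      by (simp add: b_def power_mult_distrib mult_ac)
    show "expectation (\<lambda>\<omega>. exp (s * a * deviation lam \<xi> n \<omega>))
        \<le> exp ((s * a)\<^sup>2 * b * variance_proxy lam n)"
      unfolding b_def by (rule Suc)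
  qed simp_all
  also have "\<dots> = exp (s\<^sup>2 * b * variance_proxy lam (Suc n))"
    by (simp only: exp_add[symmetric] power_mult_distrib variance_proxy.simps a_def[symmetric])
       (simp add: algebra_simps)
  finally show ?case unfolding b_def .
qed

lemma deviation_tail:
  assumes eig: "R *v \<xi> = lam *\<^sub>R \<xi>" and lam: "\<bar>lam\<bar> \<le> 1" and \<xi>: "\<xi> $ 1 \<noteq> \<xi> $ 2" and u: "0 < u"
  shows "prob {\<omega> \<in> space M. u < deviation lam \<xi> (Suc n) \<omega>}
    \<le> exp (- (2 * u\<^sup>2 / ((\<xi> $ 1 - \<xi> $ 2)\<^sup>2 * variance_proxy lam (Suc n))))"
proof -
  define B where "B = (\<xi> $ 1 - \<xi> $ 2)\<^sup>2 / 8 * variance_proxy lam (Suc n)"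
  have B: "0 < B"
    unfolding B_def using \<xi> variance_proxy_Suc_pos[of lam n]
    by (simp del: variance_proxy.simps)
  \<comment> \<open>the minimiser of the Chernoff exponent \<open>s\<^sup>2 B - s u\<close>\<close>
  define s where "s = u / (2 * B)"
  have s: "0 < s" using B u by (simp add: s_def)
  note int = integrable_exp_deviation[of s lam \<xi> "Suc n"]
  have sets: "{\<omega> \<in> space M. exp (s * u) \<le> exp (s * deviation lam \<xi> (Suc n) \<omega>)} \<in> events"
    using borel_measurable_integrable[OF int] by measurable
  have "prob {\<omega> \<in> space M. u < deviation lam \<xi> (Suc n) \<omega>}
      \<le> prob {\<omega> \<in> space M. exp (s * u) \<le> exp (s * deviation lam \<xi> (Suc n) \<omega>)}"
    using sets s by (intro finite_measure_mono) auto
  also have "\<dots> \<le> expectation (\<lambda>\<omega>. exp (s * deviation lam \<xi> (Suc n) \<omega>)) / exp (s * u)"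
    by (rule integral_Markov_inequality_measure[where A = "{}"]) (use int in auto)
  also have "\<dots> \<le> exp (s\<^sup>2 * B) / exp (s * u)"
    using deviation_subgaussian[OF eig lam, of s "Suc n"]
    by (intro divide_right_mono) (simp_all add: B_def mult.assoc del: variance_proxy.simps)
  also have "\<dots> = exp (- (u\<^sup>2 / (4 * B)))"
    using B by (simp add: s_def power2_eq_square divide_simps flip: exp_diff)
  also have "u\<^sup>2 / (4 * B) = 2 * u\<^sup>2 / ((\<xi> $ 1 - \<xi> $ 2)\<^sup>2 * variance_proxy lam (Suc n))"
    by (simp add: B_def mult.commute del: variance_proxy.simps)
  finally show ?thesis .
qed

end

theorem theorem2p1:
  fixes M :: "'a measure" and F :: "nat \<Rightarrow> 'a measure"
    and R :: "real ^ 2 ^ 2" and c0 \<xi> :: "real ^ 2" and lam :: real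
    and X C :: "nat \<Rightarrow> 'a \<Rightarrow> real ^ 2"
  assumes urn: "two_color_urn M F R c0 X C"
    and lambda: "-1 < lam" "lam < 1"
    and eigenvector: "R *v \<xi> = lam *\<^sub>R \<xi>" "\<xi> \<noteq> 0"
  shows "\<exists>(c::real) (f :: nat \<Rightarrow> real).
    0 < c \<and> (\<forall>n\<ge>1. 0 < f n) \<and> strict_mono_on {1..} f \<and>
    (\<forall>t>0. \<forall>n\<ge>1.
      measure M {\<omega> \<in> space M.
        C (n + 1) \<omega> \<bullet> \<xi> - (\<Prod>j=0..n. 1 + lam / (real j + 1)) * (C 0 \<omega> \<bullet> \<xi>) > (real n + 1) * t}
      \<le> exp (- c * t\<^sup>2 * f n))"
proof -
  interpret two_color_urn M F R c0 X C by (fact urn)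
  define f where "f n = (real n + 1)\<^sup>2 / variance_proxy lam (n + 1)" for n
  define c where "c = 2 / (\<xi> $ 1 - \<xi> $ 2)\<^sup>2"
  have \<xi>: "\<xi> $ 1 \<noteq> \<xi> $ 2"
    using stochastic_eigenvector_components_differ[OF stochastic eigenvector] lambda by simp
  have "0 < c"
    using \<xi> by (simp add: c_def)
  moreover have "0 < f n" for n
    unfolding f_def using variance_proxy_Suc_pos[of lam n]
    by (simp del: variance_proxy.simps)
  moreover have "strict_mono_on {1..} f"
    using strict_mono_square_over_variance_proxy[OF lambda]
    unfolding f_def by (rule monotone_on_subset) simp
  moreover have "measure M {\<omega> \<in> space M.
        C (n + 1) \<omega> \<bullet> \<xi> - (\<Prod>j=0..n. 1 + lam / (real j + 1)) * (C 0 \<omega> \<bullet> \<xi>) > (real n + 1) * t}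
      \<le> exp (- c * t\<^sup>2 * f n)" if "0 < t" for t n
  proof -
    have "measure M {\<omega> \<in> space M. (real n + 1) * t < deviation lam \<xi> (Suc n) \<omega>}
      \<le> exp (- (2 * ((real n + 1) * t)\<^sup>2 / ((\<xi> $ 1 - \<xi> $ 2)\<^sup>2 * variance_proxy lam (Suc n))))"
      using lambda that by (intro deviation_tail eigenvector \<xi>) auto
    also have "\<dots> = exp (- c * t\<^sup>2 * f n)"
      by (simp add: c_def f_def power_mult_distrib mult_ac del: variance_proxy.simps)
    finally show ?thesis
      by (simp add: deviation_def atLeast0AtMost lessThan_Suc_atMost del: prod.lessThan_Suc prod.atMost_Suc)
  qed
  ultimately show ?thesis by blast
qed

end
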